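(* Let $\mathbf{X}\in\mathbb{R}^{n\times d}$ (with $n,d\ge1$) be a real matrix whose columns are normalized, i.e. $\sum_{i=1}^n X_{ij}^2=1$ for all $j\in\{1,\dots,d\}$. Let $\rho$ be the spectral radius of $\mathbf{X}^T\mathbf{X}$. For $i\in\{1,\dots,n\}$ let $\kappa_i=|\{j\in\{1,\dots,d\}:X_{ij}\ne0\}|$, let $\kappa=\max_{1\le i\le n}\kappa_i$, and let $\bar\kappa=\max_{1\le j\le d}\sum_{i=1}^n\kappa_iX_{ij}^2$. Then $$\rho\le\bar\kappa\le\kappa.$$ *)

theory Defs
  imports "Jordan_Normal_Form.Spectral_Radius"
begin

text \<open>Matrix indices are 0-based.\<close>

definition normalized_cols :: "real mat \<Rightarrow> bool" where
  "normalized_cols X \<longleftrightarrow> (\<forall>j<dim_col X. (\<Sum>i<dim_row X. (X $$ (i, j))\<^sup>2) = 1)"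

definition row_nnz :: "real mat \<Rightarrow> nat \<Rightarrow> nat" where
  "row_nnz X i = card {j. j < dim_col X \<and> X $$ (i, j) \<noteq> 0}"

text \<open>The two maxima are meant for matrices with at least one row and at least one column,
  respectively; \<open>Max {}\<close> is unspecified.\<close>

definition max_row_nnz :: "real mat \<Rightarrow> nat" where
  "max_row_nnz X = Max (row_nnz X ` {..<dim_row X})"

definition max_avg_row_nnz :: "real mat \<Rightarrow> real" where
  "max_avg_row_nnz X =
    Max ((\<lambda>j. \<Sum>i<dim_row X. real (row_nnz X i) * (X $$ (i, j))\<^sup>2) ` {..<dim_col X})"

text \<open>\<open>spectral_radius\<close> is only available for complex matrices, so a real matrix is embedded
  entrywise.\<close>

definition real_spectral_radius :: "real mat \<Rightarrow> real" where
  "real_spectral_radius A = spectral_radius (map_mat complex_of_real A)"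

end

theory Submission
  imports Defs "HOL-Analysis.Convex"
begin

text \<open>For an eigenvector \<open>v\<close> of \<open>X\<^sup>T X\<close> with eigenvalue \<open>\<lambda>\<close> one has
  \<open>\<bar>\<lambda>\<bar> \<parallel>v\<parallel>\<^sup>2 = \<parallel>X v\<parallel>\<^sup>2\<close>. Cauchy--Schwarz on the support of each row bounds \<open>\<parallel>X v\<parallel>\<^sup>2\<close> by
  \<open>\<Sum>i. \<kappa>\<^sub>i (\<Sum>j. X\<^sub>i\<^sub>j\<^sup>2 \<bar>v\<^sub>j\<bar>\<^sup>2)\<close>, and exchanging the sums gives \<open>\<bar>\<lambda>\<bar> \<le> \<kappa>bar\<close>. The second bound holds
  because the column normalization turns \<open>\<kappa>bar\<close> into a maximum of weighted averages
  of the \<open>\<kappa>\<^sub>i\<close>.\<close>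

text \<open>Vanishing terms are discarded before Cauchy-Schwarz is applied against the constant 1,
  so the factor counts only the support and not all of \<open>J\<close>.\<close>

lemma norm_sum_squared_le_card_support:
  fixes z :: "'b \<Rightarrow> 'a::real_normed_vector"
  assumes "finite J"
  shows "(norm (\<Sum>j\<in>J. z j))\<^sup>2 \<le> real (card {j \<in> J. z j \<noteq> 0}) * (\<Sum>j\<in>J. (norm (z j))\<^sup>2)"
proof -
  let ?S = "{j \<in> J. z j \<noteq> 0}"
  have "(\<Sum>j\<in>J. z j) = (\<Sum>j\<in>?S. z j)"
    using assms by (intro sum.mono_neutral_right) auto
  then have "(norm (\<Sum>j\<in>J. z j))\<^sup>2 \<le> (\<Sum>j\<in>?S. norm (z j))\<^sup>2"
    by (simp add: norm_sum power_mono)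
  also have "\<dots> \<le> (\<Sum>j\<in>?S. (norm (z j))\<^sup>2) * real (card ?S)"
    by (rule sum_squared_le_sum_of_squares)
  also have "(\<Sum>j\<in>?S. (norm (z j))\<^sup>2) = (\<Sum>j\<in>J. (norm (z j))\<^sup>2)"
    using assms by (intro sum.mono_neutral_left) auto
  finally show ?thesis
    by (simp add: mult.commute)
qed

lemma norm_row_combination_squared_le:
  fixes v :: "nat \<Rightarrow> complex"
  shows "(norm (\<Sum>j<dim_col X. complex_of_real (X $$ (i, j)) * v j))\<^sup>2
    \<le> real (row_nnz X i) * (\<Sum>j<dim_col X. (X $$ (i, j))\<^sup>2 * (norm (v j))\<^sup>2)"
proof -
  let ?z = "\<lambda>j. complex_of_real (X $$ (i, j)) * v j"
  \<comment> \<open>A product can also vanish because \<open>v j\<close> is zero, so its support is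
    only contained in that of row \<open>i\<close>.\<close>
  have "card {j \<in> {..<dim_col X}. ?z j \<noteq> 0} \<le> row_nnz X i"
    unfolding row_nnz_def by (rule card_mono) auto
  then have "real (card {j \<in> {..<dim_col X}. ?z j \<noteq> 0}) * (\<Sum>j<dim_col X. (norm (?z j))\<^sup>2)
    \<le> real (row_nnz X i) * (\<Sum>j<dim_col X. (norm (?z j))\<^sup>2)"
    by (intro mult_right_mono sum_nonneg) auto
  with norm_sum_squared_le_card_support[of "{..<dim_col X}" ?z] show ?thesis
    by (simp add: norm_mult power_mult_distrib)
qed

text \<open>Pairing the eigenvalue equation with the conjugate of \<open>v\<close> moves the
  transpose to the other side and leaves the squared norm of the image vector.\<close>

lemma gram_eigenvalue_identity:
  fixes x :: "'a \<Rightarrow> 'b \<Rightarrow> real" and v :: "'b \<Rightarrow> complex"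
  assumes "\<And>j. j \<in> J \<Longrightarrow>
    (\<Sum>i\<in>I. complex_of_real (x i j) * (\<Sum>k\<in>J. complex_of_real (x i k) * v k)) = l * v j"
  shows "norm l * (\<Sum>j\<in>J. (norm (v j))\<^sup>2)
    = (\<Sum>i\<in>I. (norm (\<Sum>k\<in>J. complex_of_real (x i k) * v k))\<^sup>2)"
proof -
  let ?y = "\<lambda>i. \<Sum>k\<in>J. complex_of_real (x i k) * v k"
  have "l * complex_of_real (\<Sum>j\<in>J. (norm (v j))\<^sup>2) = (\<Sum>j\<in>J. (l * v j) * cnj (v j))"
    by (simp only: of_real_sum complex_norm_square sum_distrib_left mult.assoc)
  also have "\<dots> = (\<Sum>j\<in>J. (\<Sum>i\<in>I. complex_of_real (x i j) * ?y i) * cnj (v j))"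
    by (rule sum.cong) (simp_all add: assms)
  also have "\<dots> = (\<Sum>j\<in>J. \<Sum>i\<in>I. ?y i * (complex_of_real (x i j) * cnj (v j)))"
    by (subst sum_distrib_right) (simp only: mult_ac)
  also have "\<dots> = (\<Sum>i\<in>I. ?y i * (\<Sum>j\<in>J. complex_of_real (x i j) * cnj (v j)))"
    by (subst sum.swap) (simp only: sum_distrib_left)
  \<comment> \<open>Since \<open>x\<close> is real, the inner sum is the conjugate of
    \<open>?y i\<close>.\<close>
  also have "\<dots> = complex_of_real (\<Sum>i\<in>I. (norm (?y i))\<^sup>2)"
    by (simp add: complex_norm_square del: of_real_power)
  finally have eq: "l * complex_of_real (\<Sum>j\<in>J. (norm (v j))\<^sup>2)
    = complex_of_real (\<Sum>i\<in>I. (norm (?y i))\<^sup>2)" .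
  \<comment> \<open>Both sums are nonnegative reals, so taking norms affects only \<open>l\<close>;
    there is no need to show first that \<open>l\<close> is real.\<close>
  have "norm l * (\<Sum>j\<in>J. (norm (v j))\<^sup>2) = norm (l * complex_of_real (\<Sum>j\<in>J. (norm (v j))\<^sup>2))"
    by (simp only: norm_mult norm_of_real) (simp add: sum_nonneg)
  also have "\<dots> = (\<Sum>i\<in>I. (norm (?y i))\<^sup>2)"
    unfolding eq norm_of_real by (simp add: sum_nonneg)
  finally show ?thesis .
qed

lemma eigenvalue_gram_le_max_avg_row_nnz:
  assumes ev: "eigenvector (map_mat complex_of_real (X\<^sup>T * X)) v l"
  shows "norm l \<le> max_avg_row_nnz X"
proof -
  let ?I = "{..<dim_row X}" and ?J = "{..<dim_col X}"
  let ?A = "map_mat complex_of_real (X\<^sup>T * X)"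
  let ?N = "\<Sum>j\<in>?J. (norm (v $ j))\<^sup>2"
  from ev have v: "v \<in> carrier_vec (dim_col X)" and v0: "v \<noteq> 0\<^sub>v (dim_col X)"
    and Av: "?A *\<^sub>v v = l \<cdot>\<^sub>v v"
    by (auto simp: eigenvector_def)
  \<comment> \<open>Entrywise form of the eigenvalue equation, with the product reassociated so that
    \<open>X\<close> acts on \<open>v\<close> first.\<close>
  have "(\<Sum>i\<in>?I. complex_of_real (X $$ (i, j)) *
      (\<Sum>k\<in>?J. complex_of_real (X $$ (i, k)) * v $ k)) = l * v $ j" if j: "j \<in> ?J" for j
  proof -
    have "l * v $ j = (?A *\<^sub>v v) $ j"
      using v j by (simp add: Av)
    also have "\<dots> = (\<Sum>k\<in>?J. (\<Sum>i\<in>?I. complex_of_real (X $$ (i, j))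
        * complex_of_real (X $$ (i, k))) * v $ k)"
      using v j by (simp add: scalar_prod_def atLeast0LessThan)
    also have "\<dots> = (\<Sum>k\<in>?J. \<Sum>i\<in>?I. complex_of_real (X $$ (i, j))
        * (complex_of_real (X $$ (i, k)) * v $ k))"
      by (simp only: sum_distrib_right mult.assoc)
    also have "\<dots> = (\<Sum>i\<in>?I. complex_of_real (X $$ (i, j)) *
      (\<Sum>k\<in>?J. complex_of_real (X $$ (i, k)) * v $ k))"
      by (subst sum.swap) (simp only: sum_distrib_left)
    finally show ?thesis by simp
  qed
  from gram_eigenvalue_identity[where x = "\<lambda>i j. X $$ (i, j)" and v = "\<lambda>j. v $ j", OF this]
  have "norm l * ?N
      = (\<Sum>i\<in>?I. (norm (\<Sum>k\<in>?J. complex_of_real (X $$ (i, k)) * v $ k))\<^sup>2)" .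
  also have "\<dots> \<le> (\<Sum>i\<in>?I. real (row_nnz X i)
      * (\<Sum>j\<in>?J. (X $$ (i, j))\<^sup>2 * (norm (v $ j))\<^sup>2))"
    by (intro sum_mono norm_row_combination_squared_le)
  also have "\<dots> = (\<Sum>i\<in>?I. \<Sum>j\<in>?J. real (row_nnz X i) * (X $$ (i, j))\<^sup>2 * (norm (v $ j))\<^sup>2)"
    by (simp only: sum_distrib_left mult.assoc)
  also have "\<dots> = (\<Sum>j\<in>?J. (\<Sum>i\<in>?I. real (row_nnz X i) * (X $$ (i, j))\<^sup>2) * (norm (v $ j))\<^sup>2)"
    by (subst sum.swap) (simp only: sum_distrib_right)
  \<comment> \<open>The coefficient of each squared entry of \<open>v\<close> is one of the column
    averages over which the maximum is taken.\<close>
  also have "\<dots> \<le> (\<Sum>j\<in>?J. max_avg_row_nnz X * (norm (v $ j))\<^sup>2)"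
    unfolding max_avg_row_nnz_def by (intro sum_mono mult_right_mono Max_ge) auto
  also have "\<dots> = max_avg_row_nnz X * ?N"
    by (simp only: sum_distrib_left)
  finally have "norm l * ?N \<le> max_avg_row_nnz X * ?N" .
  moreover from v v0 obtain j where "j < dim_col X" "v $ j \<noteq> 0"
    by (metis carrier_vecD eq_vecI index_zero_vec)
  then have "?N > 0"
    by (intro sum_pos2[of _ j]) auto
  ultimately show ?thesis by simp
qed

lemma max_avg_row_nnz_le_max_row_nnz:
  assumes "dim_col X \<ge> 1" and "normalized_cols X"
  shows "max_avg_row_nnz X \<le> real (max_row_nnz X)"
proof -
  have "(\<Sum>i<dim_row X. real (row_nnz X i) * (X $$ (i, j))\<^sup>2) \<le> real (max_row_nnz X)"
    if "j < dim_col X" for j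
  proof -
    have "(\<Sum>i<dim_row X. real (row_nnz X i) * (X $$ (i, j))\<^sup>2)
      \<le> (\<Sum>i<dim_row X. real (max_row_nnz X) * (X $$ (i, j))\<^sup>2)"
      unfolding max_row_nnz_def by (intro sum_mono mult_right_mono) auto
    \<comment> \<open>With the constant pulled out, what remains is the squared norm of column
      \<open>j\<close>, which is 1.\<close>
    also have "\<dots> = real (max_row_nnz X)"
      using assms(2) that by (simp add: normalized_cols_def flip: sum_distrib_left)
    finally show ?thesis .
  qed
  then show ?thesis
    using assms(1) unfolding max_avg_row_nnz_def
    by (intro Max.boundedI) (auto simp: lessThan_empty_iff)
qed

theorem lemma1:
  fixes X :: "real mat" and n d :: nat
  assumes "n \<ge> 1" and "d \<ge> 1"
    and "X \<in> carrier_mat n d"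
    and "normalized_cols X"
  shows "real_spectral_radius (X\<^sup>T * X) \<le> max_avg_row_nnz X
    \<and> max_avg_row_nnz X \<le> real (max_row_nnz X)"
proof
  let ?A = "map_mat complex_of_real (X\<^sup>T * X)"
  have "?A \<in> carrier_mat d d" and "d > 0"
    using assms by auto
  \<comment> \<open>In positive dimension the spectral radius is attained, so bounding every single
    eigenvalue suffices.\<close>
  from spectral_radius_mem_max(1)[OF this] obtain v l
    where "eigenvector ?A v l" and "norm l = spectral_radius ?A"
    by (auto simp: spectrum_def eigenvalue_def)
  then show "real_spectral_radius (X\<^sup>T * X) \<le> max_avg_row_nnz X"
    using eigenvalue_gram_le_max_avg_row_nnz[of X v l] by (simp add: real_spectral_radius_def)
  show "max_avg_row_nnz X \<le> real (max_row_nnz X)"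
    using assms by (intro max_avg_row_nnz_le_max_row_nnz) auto
qed

end
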